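(* Let $r\ge2$ and $A=\{a_1,a_2,\ldots,a_r\}\subset\mathbb{N}$ with $1<a_1<a_2<\cdots<a_r$ and the $a_i$ pairwise coprime. Then $\overline{\rho}(A)>\rho(A)$.
   Context: A set $S$ of positive integers is $A$-quotient-free if there are no $x,y\in S$ with $x/y\in A$. For $X>0$ let $[X]=\{k\in\mathbb{N}:k\le X\}$. For $S\subseteq\mathbb{N}$ let $\overline{\delta}(S)=\limsup_{X\to\infty}|S\cap[X]|/X$; if $\lim_{X\to\infty}|S\cap[X]|/X$ exists it is the asymptotic density $\delta(S)$. $\overline{\rho}(A)$ is the supremum of $\overline{\delta}(S)$ over all $A$-quotient-free sets $S$; $\rho(A)$ is the supremum of $\delta(S)$ over all $A$-quotient-free sets $S$ for which $\delta(S)$ exists. *)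

theory Defs
  imports "HOL-Analysis.Analysis"
begin

definition quotient_free :: "nat set \<Rightarrow> nat set \<Rightarrow> bool" where
  "quotient_free A S \<longleftrightarrow>
     (\<forall>x\<in>S. 0 < x) \<and> \<not> (\<exists>x\<in>S. \<exists>y\<in>S. real x / real y \<in> real ` A)"

(* The natural numbers of the source are the positive integers, hence 0 is excluded. *)
definition initial_segment :: "real \<Rightarrow> nat set" where
  "initial_segment X = {k. 0 < k \<and> real k \<le> X}"

definition upper_density :: "nat set \<Rightarrow> ereal" where
  "upper_density S =
     Limsup at_top (\<lambda>X::real. ereal (real (card (S \<inter> initial_segment X)) / X))"

definition has_asymptotic_density :: "nat set \<Rightarrow> real \<Rightarrow> bool" where
  "has_asymptotic_density S d \<longleftrightarrow>
     ((\<lambda>X::real. real (card (S \<inter> initial_segment X)) / X) \<longlongrightarrow> d) at_top"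

(* Both suprema are taken in the extended reals, so that Sup needs no boundedness side
   condition; all the densities involved lie in [0, 1]. *)
definition upper_rho :: "nat set \<Rightarrow> ereal" where
  "upper_rho A = Sup {upper_density S | S. quotient_free A S}"

definition rho :: "nat set \<Rightarrow> ereal" where
  "rho A = Sup {ereal d | S d. quotient_free A S \<and> has_asymptotic_density S d}"

end

theory Submission
  imports Defs
begin

text \<open>
  Let \<open>E\<close> be the set of positive integers \<open>n\<close> for which the multiplicities of the elements of \<open>A\<close>
  in \<open>n\<close> have an even sum. Multiplying by an element of \<open>A\<close> changes the parity, so \<open>E\<close> is
  \<open>A\<close>-quotient-free. Weighting \<open>n\<close> by \<open>1 / n\<close> turns dilation by \<open>a\<close> into multiplication by \<open>1 / a\<close>,
  up to a bounded error, and for this weight \<open>E\<close> is extremal, also up to a bounded error. Since a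
  set with a density has the same logarithmic density, \<open>\<rho>(A)\<close> is at most the upper density of \<open>E\<close>.

  For a single bound \<open>X\<close> one can do better. For \<open>m\<close> in a suitable interval just below \<open>X / v\<close>, the
  products of \<open>m\<close> with monomials in \<open>A\<close> that stay below \<open>X\<close> include more odd than even monomials
  (e.g. \<open>m\<close>, \<open>m a\<^sub>1\<close>, \<open>m a\<^sub>2\<close> when \<open>v = a\<^sub>2 < a\<^sub>1\<^sup>2\<close>), and swapping parities there gains a positive
  proportion of \<open>X\<close>. The upper density only sees a sparse sequence of bounds \<open>X\<close>, so these finite
  improvements can be glued together.
\<close>

section \<open>Integer forms of quotient-freeness and of initial segments\<close>

lemma quotient_free_iff:
  "quotient_free A S \<longleftrightarrow> (\<forall>x\<in>S. 0 < x) \<and> (\<forall>a\<in>A. \<forall>y\<in>S. a * y \<notin> S)"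
proof -
  have "(\<exists>x\<in>S. \<exists>y\<in>S. real x / real y \<in> real ` A) \<longleftrightarrow> (\<exists>a\<in>A. \<exists>y\<in>S. a * y \<in> S)"
    if pos: "\<forall>x\<in>S. 0 < x"
  proof -
    have "real x / real y = real a \<longleftrightarrow> x = a * y" if "y \<in> S" for x y a
    proof -
      have "real y \<noteq> 0"
        using pos that by auto
      then have "real x / real y = real a \<longleftrightarrow> real x = real (a * y)"
        by (auto simp: field_simps)
      then show ?thesis
        by (simp only: of_nat_eq_iff)
    qed
    then show ?thesis
      by (auto simp: image_iff)
  qed
  then show ?thesis
    unfolding quotient_free_def by blast
qed

lemma initial_segment_eq: "initial_segment X = {1..nat \<lfloor>X\<rfloor>}"
proof -
  have "real k \<le> X \<longleftrightarrow> k \<le> nat \<lfloor>X\<rfloor>" if "0 < k" for k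
  proof -
    have "k \<le> nat \<lfloor>X\<rfloor> \<longleftrightarrow> int k \<le> \<lfloor>X\<rfloor>"
      using that by arith
    then show ?thesis
      by (simp add: le_floor_iff)
  qed
  then show ?thesis
    unfolding initial_segment_def by auto
qed

lemma finite_initial_segment [simp]: "finite (initial_segment X)"
  by (simp add: initial_segment_eq)

lemma initial_segment_of_nat [simp]: "initial_segment (real n) = {1..n}"
  by (simp add: initial_segment_eq)

lemma card_initial_segment_le:
  assumes "0 \<le> X"
  shows "real (card (initial_segment X)) \<le> X"
  using assms by (simp add: initial_segment_eq)

section \<open>Multiplicities\<close>

text \<open>The elements of \<open>A\<close> need not be prime, so multiplicities are not additive
  in general; a factor coprime to \<open>a\<close> still cancels from divisibility by every power of
  \<open>a\<close>.\<close>

lemma multiplicity_mult_coprime: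
  fixes a b n :: nat
  assumes "coprime a b"
  shows "multiplicity a (b * n) = multiplicity a n"
proof -
  have "a ^ k dvd b * n \<longleftrightarrow> a ^ k dvd n" for k
    using assms by (simp add: coprime_dvd_mult_right_iff)
  then show ?thesis
    unfolding multiplicity_def by simp
qed

definition total_mult :: "nat set \<Rightarrow> nat \<Rightarrow> nat"
  where "total_mult A n = (\<Sum>a\<in>A. multiplicity a n)"

definition even_part :: "nat set \<Rightarrow> nat set"
  where "even_part A = {n. 0 < n \<and> even (total_mult A n)}"

definition even_at :: "nat set \<Rightarrow> nat set"
  where "even_at B = {n. 0 < n \<and> (\<forall>b\<in>B. even (multiplicity b n))}"

definition coprime_base :: "nat set \<Rightarrow> bool"
  where "coprime_base A \<longleftrightarrow> finite A \<and> (\<forall>a\<in>A. 1 < a) \<and> pairwise coprime A"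

lemma coprime_base_subset: "coprime_base B \<Longrightarrow> A \<subseteq> B \<Longrightarrow> coprime_base A"
  unfolding coprime_base_def by (auto intro: finite_subset pairwise_subset)

lemma total_mult_insert:
  "finite A \<Longrightarrow> a \<notin> A \<Longrightarrow> total_mult (insert a A) n = multiplicity a n + total_mult A n"
  by (simp add: total_mult_def)

lemma total_mult_mult_coprime:
  assumes "\<And>a. a \<in> A \<Longrightarrow> coprime a m"
  shows "total_mult A (m * n) = total_mult A n"
  using assms by (simp add: total_mult_def multiplicity_mult_coprime)

lemma total_mult_times:
  assumes "coprime_base A" "a \<in> A" "0 < n"
  shows "total_mult A (a * n) = Suc (total_mult A n)"
proof -
  have A: "A = insert a (A - {a})" and fin: "finite (A - {a})"
    using assms by (auto simp: coprime_base_def)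
  have "total_mult (A - {a}) (a * n) = total_mult (A - {a}) n"
    using assms by (intro total_mult_mult_coprime) (auto simp: coprime_base_def pairwise_def)
  moreover have "multiplicity a (a * n) = Suc (multiplicity a n)"
    using assms by (intro multiplicity_times_same) (auto simp: coprime_base_def)
  ultimately show ?thesis
    using fin total_mult_insert[of "A - {a}" a] A[symmetric] by simp
qed

lemma quotient_free_even_part:
  assumes "coprime_base A"
  shows "quotient_free A (even_part A)"
  using assms by (auto simp: quotient_free_iff even_part_def total_mult_times)

section \<open>The even part maximises reciprocal sums\<close>

definition recip_sum :: "nat set \<Rightarrow> nat \<Rightarrow> real"
  where "recip_sum S X = (\<Sum>n\<in>S \<inter> {1..X}. 1 / real n)"

lemma recip_sum_mono: "S \<subseteq> T \<Longrightarrow> recip_sum S X \<le> recip_sum T X"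
  unfolding recip_sum_def by (intro sum_mono2) auto

lemma recip_sum_mono_bound: "X \<le> Y \<Longrightarrow> recip_sum S X \<le> recip_sum S Y"
  unfolding recip_sum_def by (intro sum_mono2) auto

lemma recip_sum_Un_disjoint:
  "S \<inter> T = {} \<Longrightarrow> recip_sum (S \<union> T) X = recip_sum S X + recip_sum T X"
  unfolding recip_sum_def Int_Un_distrib2 by (intro sum.union_disjoint) auto

lemma recip_sum_image_mult:
  assumes "0 < a"
  shows "recip_sum ((*) a ` S) X = recip_sum S (X div a) / real a"
proof -
  have img: "(*) a ` S \<inter> {1..X} = (*) a ` (S \<inter> {1..X div a})"
    using assms by (auto simp: less_eq_div_iff_mult_less_eq mult.commute)
  have "inj_on ((*) a) (S \<inter> {1..X div a})"
    using assms by (auto intro: inj_onI)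
  then show ?thesis
    unfolding recip_sum_def img
    by (subst sum.reindex) (auto simp: sum_divide_distrib mult.commute intro!: sum.cong)
qed

text \<open>The discarded terms have \<open>n > X div a\<close>, so each is at most
  \<open>a / X\<close>, and there are at most \<open>X\<close> of them.\<close>

lemma recip_sum_le_div:
  assumes "0 < a"
  shows "recip_sum S X \<le> recip_sum S (X div a) + real a"
proof -
  let ?D = "S \<inter> {X div a<..X}"
  have split: "S \<inter> {1..X} = (S \<inter> {1..X div a}) \<union> ?D"
    using div_le_dividend[of X a] by (auto simp del: div_le_dividend)
  have "(\<Sum>n\<in>?D. 1 / real n) \<le> (\<Sum>n\<in>?D. real a / real X)"
  proof (intro sum_mono)
    fix n assume n: "n \<in> ?D"
    then have "X \<le> a * n"
      using assms by (metis IntD2 div_less_iff_less_mult greaterThanAtMost_iff less_imp_le mult.commute)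
    then have "real X \<le> real a * real n"
      by (metis of_nat_le_iff of_nat_mult)
    moreover have "0 < n" "0 < X"
      using n by auto
    ultimately show "1 / real n \<le> real a / real X"
      by (simp add: field_simps)
  qed
  also have "\<dots> = real (card ?D) * (real a / real X)"
    by simp
  also have "\<dots> \<le> real X * (real a / real X)"
  proof (intro mult_right_mono)
    have "card ?D \<le> card {X div a<..X}"
      by (intro card_mono) auto
    then show "real (card ?D) \<le> real X"
      by simp
  qed auto
  also have "\<dots> \<le> real a"
    by simp
  finally have "(\<Sum>n\<in>?D. 1 / real n) \<le> real a" .
  moreover have "recip_sum S X = recip_sum S (X div a) + (\<Sum>n\<in>?D. 1 / real n)"
    unfolding recip_sum_def split by (intro sum.union_disjoint) auto
  ultimately show ?thesis
    by simp
qed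

text \<open>
  Splitting off \<open>a\<close> yields disjoint \<open>A\<close>-quotient-free sets \<open>S0\<close>, \<open>S1\<close> with \<open>S = S0 \<union> a S1\<close>, both inside the
  integers with even multiplicity of \<open>a\<close>. The weight \<open>w(S0) + w(S1) / a\<close> is the convex combination
  \<open>(1 - 1/a) w(S0) + (1/a) w(S0 \<union> S1)\<close>, whose first part is bounded by induction and whose second
  part is bounded trivially. Parity constraints at the elements already split off are recorded by \<open>B\<close>.
\<close>

lemma recip_sum_quotient_free_le:
  assumes "finite A" "coprime_base (A \<union> B)" "A \<inter> B = {}"
    and "quotient_free A S" "S \<subseteq> even_at B"
  shows "recip_sum S X \<le> recip_sum (even_part A \<inter> even_at B) X + real (card A)"
  using assms
proof (induction A arbitrary: B S rule: finite_induct)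
  case empty
  have "S \<subseteq> even_part {} \<inter> even_at B"
    using empty.prems by (auto simp: even_part_def total_mult_def even_at_def)
  then show ?case
    by (simp add: recip_sum_mono)
next
  case (insert a A)
  define P where "P = even_at (insert a B)"
  define S0 where "S0 = S \<inter> P"
  define S1 where "S1 = {n \<in> P. a * n \<in> S}"
  have base: "coprime_base (insert a A)" and base': "coprime_base (A \<union> insert a B)"
    using insert.prems(1) by (auto elim: coprime_base_subset)
  have a: "1 < a" "0 < a"
    using base by (auto simp: coprime_base_def)
  have free: "\<And>c y. c \<in> insert a A \<Longrightarrow> y \<in> S \<Longrightarrow> c * y \<notin> S" and pos: "\<And>x. x \<in> S \<Longrightarrow> 0 < x"
    using insert.prems(3) by (auto simp: quotient_free_iff)
  have mult_a: "multiplicity a (a * n) = Suc (multiplicity a n)" if "0 < n" for n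
    using a that by (intro multiplicity_times_same) auto
  have mult_b: "multiplicity b (a * n) = multiplicity b n" if "b \<in> A \<union> B" for b n
  proof -
    have "b \<noteq> a"
      using that insert.hyps insert.prems(2) by auto
    then show ?thesis
      using that insert.prems(1)
      by (intro multiplicity_mult_coprime) (auto simp: coprime_base_def pairwise_def)
  qed
  have tot: "total_mult A (a * n) = total_mult A n" for n
    by (simp add: total_mult_def mult_b)
  have P_times: "a * n \<in> even_at B - P" if "n \<in> P" for n
    using that a by (auto simp: P_def even_at_def mult_a mult_b)
  \<comment> \<open>An element of \<open>S\<close> outside \<open>P\<close> has odd multiplicity of
    \<open>a\<close>; dividing out one \<open>a\<close> makes it even and keeps the multiplicities
    at \<open>B\<close>.\<close>
  have S_eq: "S = S0 \<union> (*) a ` S1"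
  proof (intro equalityI subsetI)
    fix n assume n: "n \<in> S"
    show "n \<in> S0 \<union> (*) a ` S1"
    proof (cases "n \<in> P")
      case True
      then show ?thesis
        using n by (simp add: S0_def)
    next
      case False
      then have odd: "odd (multiplicity a n)"
        using n insert.prems(4) by (auto simp: P_def even_at_def)
      then have "a dvd n"
        using not_dvd_imp_multiplicity_0 by fastforce
      then obtain k where k: "n = a * k" ..
      have "0 < k"
        using pos[OF n] k by auto
      then have "k \<in> P"
        using n odd insert.prems(4) k by (auto simp: P_def even_at_def mult_a mult_b)
      then show ?thesis
        using n k by (auto simp: S1_def)
    qed
  qed (auto simp: S0_def S1_def)
  have disj_S: "S0 \<inter> (*) a ` S1 = {}"
    using P_times by (auto simp: S0_def S1_def)
  have S: "recip_sum S X \<le> recip_sum S0 X + recip_sum S1 X / a"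
  proof -
    have "recip_sum S X = recip_sum S0 X + recip_sum S1 (X div a) / a"
      by (subst S_eq) (simp add: recip_sum_Un_disjoint[OF disj_S] recip_sum_image_mult a)
    moreover have "recip_sum S1 (X div a) \<le> recip_sum S1 X"
      by (intro recip_sum_mono_bound) simp
    ultimately show ?thesis
      using a by (simp add: divide_right_mono)
  qed
  \<comment> \<open>A common element \<open>n\<close> would put both \<open>n\<close> and
    \<open>a * n\<close> into \<open>S\<close>.\<close>
  have disj: "S0 \<inter> S1 = {}"
    using free by (auto simp: S0_def S1_def)
  have P: "recip_sum S0 X + recip_sum S1 X \<le> recip_sum P X"
    unfolding recip_sum_Un_disjoint[OF disj, symmetric]
    by (intro recip_sum_mono) (auto simp: S0_def S1_def)
  have "recip_sum S0 X \<le> recip_sum (even_part A \<inter> P) X + card A"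
    unfolding P_def
  proof (intro insert.IH base')
    show "A \<inter> insert a B = {}"
      using insert.hyps insert.prems(2) by auto
    show "quotient_free A S0"
      using free pos by (auto simp: quotient_free_iff S0_def)
    show "S0 \<subseteq> even_at (insert a B)"
      by (auto simp: S0_def P_def)
  qed
  then have IH: "(1 - 1 / a) * recip_sum S0 X \<le> (1 - 1 / a) * (recip_sum (even_part A \<inter> P) X + card A)"
    using a by (intro mult_left_mono) auto
  \<comment> \<open>These play the roles of \<open>S0\<close> and \<open>S1\<close> for the extremal
    set: multiplying by \<open>a\<close> repairs the odd totals in \<open>E1\<close>.\<close>
  define E0 where "E0 = even_part A \<inter> P"
  define E1 where "E1 = P - even_part A"
  have "recip_sum P X = recip_sum (E0 \<union> E1) X"
    by (rule arg_cong[where f = "\<lambda>T. recip_sum T X"]) (auto simp: E0_def E1_def)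
  also have "\<dots> = recip_sum E0 X + recip_sum E1 X"
    by (intro recip_sum_Un_disjoint) (auto simp: E0_def E1_def)
  finally have P_split: "recip_sum P X = recip_sum E0 X + recip_sum E1 X" .
  \<comment> \<open>The truncation loss \<open>a\<close> is divided by \<open>a\<close>, so each
    element of \<open>A\<close> adds one to the final error \<open>card A\<close>.\<close>
  have "recip_sum E1 X / a \<le> (recip_sum E1 (X div a) + a) / a"
    using a by (intro divide_right_mono recip_sum_le_div) auto
  then have E1: "recip_sum E1 X / a \<le> recip_sum E1 (X div a) / a + 1"
    using a by (simp add: add_divide_distrib)
  have "recip_sum E0 X + recip_sum E1 (X div a) / a = recip_sum (E0 \<union> (*) a ` E1) X"
    using P_times a
    by (subst recip_sum_Un_disjoint) (auto simp: recip_sum_image_mult E0_def E1_def)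
  also have "\<dots> \<le> recip_sum (even_part (insert a A) \<inter> even_at B) X"
  proof (intro recip_sum_mono subsetI)
    fix n assume "n \<in> E0 \<union> (*) a ` E1"
    then show "n \<in> even_part (insert a A) \<inter> even_at B"
      using insert.hyps a
      by (auto simp: E0_def E1_def P_def even_part_def even_at_def total_mult_insert tot mult_a mult_b)
  qed
  finally have E: "recip_sum E0 X + recip_sum E1 (X div a) / a
    \<le> recip_sum (even_part (insert a A) \<inter> even_at B) X" .
  have "recip_sum S X \<le> (1 - 1 / a) * recip_sum S0 X + (recip_sum S0 X + recip_sum S1 X) / a"
    using S by (simp add: add_divide_distrib left_diff_distrib)
  also have "\<dots> \<le> (1 - 1 / a) * (recip_sum E0 X + card A) + recip_sum P X / a"
    using IH P a unfolding E0_def by (intro add_mono divide_right_mono) auto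
  also have "\<dots> \<le> recip_sum E0 X + recip_sum E1 X / a + card A"
    using a by (simp add: P_split field_simps)
  also have "\<dots> \<le> recip_sum (even_part (insert a A) \<inter> even_at B) X + card (insert a A)"
    using E1 E insert.hyps by simp
  finally show ?case .
qed

section \<open>Sets with an asymptotic density\<close>

definition count :: "nat set \<Rightarrow> nat \<Rightarrow> real"
  where "count S n = real (card (S \<inter> {1..n}))"

lemma count_Suc: "count S (Suc n) = count S n + (if Suc n \<in> S then 1 else 0)"
proof -
  have "S \<inter> {1..Suc n} = (if Suc n \<in> S then insert (Suc n) (S \<inter> {1..n}) else S \<inter> {1..n})"
    by (auto simp: le_Suc_eq)
  then show ?thesis
    by (simp add: count_def)
qed

lemma recip_sum_Suc:
  "recip_sum S (Suc n) = recip_sum S n + (if Suc n \<in> S then 1 / real (Suc n) else 0)"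
proof -
  have "S \<inter> {1..Suc n} = (if Suc n \<in> S then insert (Suc n) (S \<inter> {1..n}) else S \<inter> {1..n})"
    by (auto simp: le_Suc_eq)
  then show ?thesis
    by (simp add: recip_sum_def)
qed

text \<open>Abel summation. Dividing the boundary term by \<open>Suc X\<close> covers
  \<open>X = 0\<close> and turns the induction step into one algebraic identity.\<close>

lemma recip_sum_by_parts:
  "recip_sum S X = (\<Sum>n<X. count S (Suc n) / (real (Suc n) * real (Suc (Suc n)))) + count S X / real (Suc X)"
proof (induction X)
  case 0
  show ?case
    by (simp add: recip_sum_def count_def)
next
  case (Suc X)
  have "count S X / real (Suc X) + (count S (Suc X) - count S X) / real (Suc X)
      = count S (Suc X) / (real (Suc X) * real (Suc (Suc X))) + count S (Suc X) / real (Suc (Suc X))"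
  proof -
    have "c0 / x + (c1 - c0) / x = c1 / (x * (x + 1)) + c1 / (x + 1)" if "0 < x" for c0 c1 x :: real
      using that by (simp add: divide_simps) (simp add: algebra_simps)
    from this[of "real (Suc X)"] show ?thesis
      by (simp add: add.commute)
  qed
  moreover have "(if Suc X \<in> S then 1 / real (Suc X) else 0) = (count S (Suc X) - count S X) / real (Suc X)"
    by (simp add: count_Suc)
  ultimately show ?case
    by (simp only: recip_sum_Suc Suc.IH sum.lessThan_Suc)
qed

text \<open>After summation by parts, a linear lead in the counts contributes terms of at least
  \<open>c / (n + 2)\<close>, and the harmonic series diverges.\<close>

lemma unbounded_recip_sum_diff:
  assumes "0 < c" and "\<And>n. n0 \<le> n \<Longrightarrow> count T n + c * real n \<le> count S n"
  shows "\<exists>X. recip_sum S X > recip_sum T X + K"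
proof (rule ccontr)
  assume "\<not> ?thesis"
  then have bound: "recip_sum S X - recip_sum T X \<le> K" for X
    by (simp add: not_less algebra_simps)
  define f where "f n = (count S (Suc n) - count T (Suc n)) / (real (Suc n) * real (Suc (Suc n)))" for n
  have parts: "recip_sum S X - recip_sum T X = (\<Sum>n<X. f n) + (count S X - count T X) / real (Suc X)" for X
    by (simp add: recip_sum_by_parts f_def sum_subtractf diff_divide_distrib)
  have f_ge: "c / real (n + n0 + 2) \<le> f (n + n0)" for n
  proof -
    have "c * real (Suc (n + n0)) \<le> count S (Suc (n + n0)) - count T (Suc (n + n0))"
      using assms(2)[of "Suc (n + n0)"] by simp
    then have "c * real (Suc (n + n0)) / (real (Suc (n + n0)) * real (Suc (Suc (n + n0)))) \<le> f (n + n0)"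
      unfolding f_def by (intro divide_right_mono) auto
    then show ?thesis
      by (simp add: add.commute)
  qed
  have "summable (\<lambda>n. f (n + n0))"
  proof (rule bounded_imp_summable)
    show "0 \<le> f (n + n0)" for n
      using f_ge[of n] \<open>0 < c\<close> by (smt (verit) divide_nonneg_nonneg of_nat_0_le_iff)
    \<comment> \<open>The boundary term is nonnegative from \<open>n0\<close> on and is dropped; the
      terms before \<open>n0\<close> move into the constant.\<close>
    show "(\<Sum>n\<le>m. f (n + n0)) \<le> K - (\<Sum>n<n0. f n)" for m
    proof -
      define X where "X = n0 + Suc m"
      have "0 \<le> c * real X"
        using \<open>0 < c\<close> by simp
      then have "0 \<le> count S X - count T X"
        using assms(2)[of X] by (simp add: X_def)
      then have "(\<Sum>n<X. f n) \<le> K"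
        using bound[of X] unfolding parts by (smt (verit) divide_nonneg_nonneg of_nat_0_le_iff)
      moreover have "(\<Sum>n<X. f n) = (\<Sum>n<n0. f n) + (\<Sum>n\<le>m. f (n + n0))"
        unfolding X_def by (induction m) (simp_all add: add.commute)
      ultimately show ?thesis
        by simp
    qed
  qed
  then have "summable (\<lambda>n. c / real (n + n0 + 2))"
    by (rule summable_comparison_test'[where N = 0])
      (use f_ge \<open>0 < c\<close> in auto)
  then have "summable (\<lambda>n. inverse c * (c / real (n + n0 + 2)))"
    by (rule summable_mult)
  then have "summable (\<lambda>n. inverse (real (n + (n0 + 2))))"
    using \<open>0 < c\<close> by (simp add: field_simps)
  then have "summable (\<lambda>n. inverse (real n))"
    by (subst (asm) summable_iff_shift)
  then show False
    using not_summable_harmonic[where 'a = real] by simp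
qed

text \<open>Otherwise \<open>S\<close> would outnumber the even part by a fixed positive proportion
  at all large bounds, and its reciprocal sum would exceed the extremal one by more than
  \<open>card A\<close>.\<close>

lemma density_le_upper_density_even_part:
  assumes "coprime_base A" "quotient_free A S" "has_asymptotic_density S d"
  shows "ereal d \<le> upper_density (even_part A)"
proof (rule ccontr)
  let ?E = "even_part A"
  assume "\<not> ?thesis"
  then have "upper_density ?E < ereal d"
    by simp
  then obtain \<beta> where \<beta>: "upper_density ?E < ereal \<beta>" "\<beta> < d"
    using ereal_dense2 by force
  define \<gamma> where "\<gamma> = (\<beta> + d) / 2"
  have \<gamma>: "\<beta> < \<gamma>" "\<gamma> < d"
    using \<beta> by (auto simp: \<gamma>_def)
  have "eventually (\<lambda>X. ereal (real (card (?E \<inter> initial_segment X)) / X) < ereal \<beta>) at_top"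
    using \<beta>(1) unfolding upper_density_def by (rule Limsup_lessD)
  moreover have "eventually (\<lambda>X. \<gamma> < real (card (S \<inter> initial_segment X)) / X) at_top"
    using assms(3) \<gamma>(2) unfolding has_asymptotic_density_def by (rule order_tendstoD)
  ultimately have "eventually (\<lambda>X. real (card (?E \<inter> initial_segment X)) / X < \<beta> \<and>
    \<gamma> < real (card (S \<inter> initial_segment X)) / X) at_top"
    by eventually_elim simp
  then obtain X0 where X0: "\<And>X. X0 \<le> X \<Longrightarrow> real (card (?E \<inter> initial_segment X)) / X < \<beta> \<and>
    \<gamma> < real (card (S \<inter> initial_segment X)) / X"
    by (auto simp: eventually_at_top_linorder)
  obtain n0 where n0: "X0 \<le> real n0" "0 < n0"
    by (metis (full_types) gr0I linear of_nat_0 order_trans real_arch_simple zero_less_one of_nat_le_iff not_one_le_zero le_0_eq)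
  have "count ?E n + (\<gamma> - \<beta>) * real n \<le> count S n" if "n0 \<le> n" for n
  proof -
    have "X0 \<le> real n" "0 < real n"
      using n0 that by auto
    then have "real (card (?E \<inter> {1..n})) < \<beta> * real n" "\<gamma> * real n < real (card (S \<inter> {1..n}))"
      using X0[of "real n"] by (auto simp: field_simps)
    then show ?thesis
      by (simp add: count_def algebra_simps)
  qed
  then obtain X where "recip_sum S X > recip_sum ?E X + card A"
    using unbounded_recip_sum_diff[of "\<gamma> - \<beta>" n0 ?E S "card A"] \<gamma> by auto
  moreover have "recip_sum S X \<le> recip_sum (?E \<inter> even_at {}) X + card A"
    using assms by (intro recip_sum_quotient_free_le)
      (auto simp: even_at_def quotient_free_iff coprime_base_def)
  moreover have "?E \<inter> even_at {} = ?E"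
    by (auto simp: even_at_def even_part_def)
  ultimately show False
    by simp
qed

section \<open>Gluing finite quotient-free sets\<close>

text \<open>Density of the order supplies a value between \<open>Limsup\<close> and \<open>c\<close>
  for the converse. The criterion reduces upper density to finding arbitrarily large good
  bounds.\<close>

lemma le_Limsup_at_top_iff:
  fixes f :: "'b :: linorder \<Rightarrow> 'a :: {complete_linorder, dense_order}"
  shows "c \<le> Limsup at_top f \<longleftrightarrow> (\<forall>y<c. \<forall>x0. \<exists>x\<ge>x0. y < f x)"
proof (intro iffI allI impI)
  fix y x0 assume *: "c \<le> Limsup at_top f" "y < c"
  show "\<exists>x\<ge>x0. y < f x"
  proof (rule ccontr)
    assume "\<not> ?thesis"
    then have "eventually (\<lambda>x. f x \<le> y) at_top"
      by (auto simp: eventually_at_top_linorder not_less)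
    then have "Limsup at_top f \<le> y"
      by (rule Limsup_bounded)
    then show False
      using * by simp
  qed
next
  assume freq: "\<forall>y<c. \<forall>x0. \<exists>x\<ge>x0. y < f x"
  show "c \<le> Limsup at_top f"
  proof (rule ccontr)
    assume "\<not> c \<le> Limsup at_top f"
    then obtain y where y: "Limsup at_top f < y" "y < c"
      using dense[of "Limsup at_top f" c] by (auto simp: not_le)
    obtain x0 where x0: "\<And>x. x0 \<le> x \<Longrightarrow> f x < y"
      using Limsup_lessD[OF y(1)] by (auto simp: eventually_at_top_linorder)
    obtain x where "x0 \<le> x" "y < f x"
      using freq y(2) by blast
    then show False
      using x0[of x] by simp
  qed
qed

text \<open>The sets \<open>T\<close> for different bounds need not be related: upper density is
  witnessed along a sparse sequence, so widely separated pieces of them can be united.\<close>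

lemma upper_rho_ge_of_finite:
  assumes "finite A"
    and "\<And>Y. \<exists>X T. Y \<le> X \<and> T \<subseteq> initial_segment X \<and> quotient_free A T \<and> \<beta> * X \<le> real (card T)"
  shows "ereal \<beta> \<le> upper_rho A"
proof -
  obtain g h where gh: "\<And>Y. Y \<le> g Y" "\<And>Y. h Y \<subseteq> initial_segment (g Y)"
    "\<And>Y. quotient_free A (h Y)" "\<And>Y. \<beta> * g Y \<le> real (card (h Y))"
    using assms(2) by metis
  \<comment> \<open>Inserting 1 covers empty \<open>A\<close> and gives \<open>M \<ge> 1\<close>,
    which makes \<open>Y\<close> increasing.\<close>
  define M where "M = real (Max (insert 1 A))"
  have M: "1 \<le> M" "\<And>a. a \<in> A \<Longrightarrow> real a \<le> M"
    using assms(1) by (auto simp: M_def)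
  \<comment> \<open>The block \<open>T k\<close> is used only on \<open>(Y k, X k]\<close>; since \<open>Y (k + 1) = M * X k\<close>, no quotient between
    different blocks lies in \<open>A\<close>, and \<open>Y k\<close> is negligible against \<open>X k\<close>.\<close>
  define Y where "Y = rec_nat 1 (\<lambda>k y. M * g (real (Suc k) * y))"
  define X where "X k = g (real (Suc k) * Y k)" for k
  define T where "T k = h (real (Suc k) * Y k)" for k
  have Y_0: "Y 0 = 1" and Y_Suc: "Y (Suc k) = M * X k" for k
    by (simp_all add: Y_def X_def)
  \<comment> \<open>The factor \<open>Suc k\<close> makes the part cut off below \<open>Y k\<close>
    at most a proportion \<open>1 / (k + 1)\<close> of \<open>X k\<close>.\<close>
  have X_ge: "real (Suc k) * Y k \<le> X k" for k
    unfolding X_def by (rule gh)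
  have Y_ge_1: "1 \<le> Y k" for k
  proof (induction k)
    case (Suc k)
    have "1 * 1 \<le> real (Suc k) * Y k"
      using Suc by (intro mult_mono) auto
    then have "1 \<le> X k"
      using X_ge[of k] by linarith
    then have "1 * 1 \<le> M * X k"
      using M by (intro mult_mono) auto
    then show ?case
      by (simp add: Y_Suc)
  qed (simp add: Y_0)
  have X_ge_Y: "Y k \<le> X k" for k
    using X_ge[of k] Y_ge_1[of k] mult_right_mono[of 1 "real (Suc k)" "Y k"] by linarith
  have X_ge_Suc: "real (Suc k) \<le> X k" for k
    using X_ge[of k] Y_ge_1[of k] mult_left_mono[of 1 "Y k" "real (Suc k)"]
    unfolding mult_1_right by linarith
  have X_pos: "0 < X k" for k
    using X_ge_Y[of k] Y_ge_1[of k] by linarith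
  have X_le_Y_Suc: "X k \<le> Y (Suc k)" for k
    using M X_pos[of k] mult_right_mono[of 1 M "X k"] by (simp add: Y_Suc)
  have "incseq Y"
    by (intro incseq_SucI order_trans[OF X_ge_Y X_le_Y_Suc])
  then have Y_mono: "i \<le> j \<Longrightarrow> Y i \<le> Y j" for i j
    by (rule incseqD)
  define S where "S = (\<Union>k. {n \<in> T k. Y k < real n})"
  have T_le: "real n \<le> X k" if "n \<in> T k" for n k
    using gh(2)[of "real (Suc k) * Y k"] that by (auto simp: T_def X_def initial_segment_def)
  have T_free: "quotient_free A (T k)" for k
    unfolding T_def by (rule gh)
  have "quotient_free A S"
    unfolding quotient_free_iff
  proof (intro conjI ballI notI)
    show "0 < x" if "x \<in> S" for x
      using that T_free by (auto simp: S_def quotient_free_iff)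
  next
    fix a y assume a: "a \<in> A" and "y \<in> S" "a * y \<in> S"
    then obtain i j where i: "a * y \<in> T i" "Y i < real (a * y)" and j: "y \<in> T j" "Y j < real y"
      by (auto simp: S_def)
    have "0 < a * y"
      using T_free[of i] i(1) unfolding quotient_free_iff by blast
    consider "i = j" | "i < j" | "j < i"
      by linarith
    then show False
    proof cases
      case 1
      then show ?thesis
        using T_free[of i] a i(1) j(1) unfolding quotient_free_iff by blast
    next
      case 2
      have "real (a * y) \<le> X i"
        using i by (intro T_le)
      also have "X i \<le> Y j"
        using X_le_Y_Suc[of i] Y_mono[of "Suc i" j] 2 by simp
      also have "Y j < real y"
        by (rule j)
      finally show ?thesis
        using \<open>0 < a * y\<close> by (simp flip: of_nat_mult)
    next
      case 3
      have "real a * real y \<le> M * X j"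
        using M(2)[OF a] T_le[OF j(1)] M(1) by (intro mult_mono) auto
      also have "\<dots> \<le> Y i"
        using Y_mono[of "Suc j" i] 3 by (simp add: Y_Suc)
      finally show ?thesis
        using i by simp
    qed
  qed
  moreover have "ereal \<beta> \<le> upper_density S"
    unfolding upper_density_def le_Limsup_at_top_iff
  proof (intro allI impI)
    fix y x0 assume y: "y < ereal \<beta>"
    show "\<exists>X\<ge>x0. y < ereal (real (card (S \<inter> initial_segment X)) / X)"
    proof -
      obtain z where z: "y < ereal z" "z < \<beta>"
        using ereal_dense2[OF y] by auto
      \<comment> \<open>\<open>k1\<close> makes the loss \<open>Y k\<close> at most
        \<open>(\<beta> - z) * X k\<close>; \<open>k2\<close> puts \<open>X k\<close> beyond
        \<open>x0\<close>.\<close>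
      obtain k1 :: nat where k1: "1 / (\<beta> - z) < real k1"
        using reals_Archimedean2 by blast
      obtain k2 :: nat where k2: "x0 < real k2"
        using reals_Archimedean2 by blast
      define k where "k = max k1 k2"
      have k: "1 / (\<beta> - z) < real (Suc k)" "x0 < real (Suc k)"
        using k1 k2 by (auto simp: k_def)
      have "T k \<subseteq> (S \<inter> initial_segment (X k)) \<union> initial_segment (Y k)"
        using T_le[of _ k] T_free[of k]
        by (auto simp: S_def initial_segment_def quotient_free_iff)
      then have "card (T k) \<le> card ((S \<inter> initial_segment (X k)) \<union> initial_segment (Y k))"
        by (intro card_mono) auto
      also have "\<dots> \<le> card (S \<inter> initial_segment (X k)) + card (initial_segment (Y k))"
        by (rule card_Un_le)
      finally have "real (card (T k)) \<le> real (card (S \<inter> initial_segment (X k))) + Y k"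
        using card_initial_segment_le[of "Y k"] Y_ge_1[of k] by linarith
      moreover have "\<beta> * X k \<le> real (card (T k))"
        unfolding T_def X_def by (rule gh)
      moreover have "Y k \<le> (\<beta> - z) * X k"
      proof -
        have "1 < (\<beta> - z) * real (Suc k)"
          using k(1) z(2) by (simp add: field_simps)
        then have "1 * Y k \<le> (\<beta> - z) * real (Suc k) * Y k"
          using Y_ge_1[of k] by (intro mult_right_mono) auto
        also have "\<dots> \<le> (\<beta> - z) * X k"
          using X_ge[of k] z(2) by (simp add: mult.assoc)
        finally show ?thesis
          by simp
      qed
      ultimately have "z * X k \<le> real (card (S \<inter> initial_segment (X k)))"
        by (simp add: algebra_simps)
      then have "z \<le> real (card (S \<inter> initial_segment (X k))) / X k"
        using X_pos[of k] by (simp add: field_simps)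
      then have "y < ereal (real (card (S \<inter> initial_segment (X k))) / X k)"
        using z(1) by (meson ereal_less_eq(3) less_le_trans)
      moreover have "x0 \<le> X k"
        using k(2) X_ge_Suc[of k] by linarith
      ultimately show "\<exists>X\<ge>x0. y < ereal (real (card (S \<inter> initial_segment X)) / X)"
        by blast
    qed
  qed
  ultimately show ?thesis
    unfolding upper_rho_def by (intro Sup_upper2[of "upper_density S"]) auto
qed

section \<open>Improving on the even part below a bound\<close>

lemma card_nat_interval_ge:
  fixes \<alpha> \<beta> :: real
  assumes "0 \<le> \<alpha>"
  shows "\<beta> - \<alpha> - 1 \<le> real (card {k::nat. \<alpha> < real k \<and> real k \<le> \<beta>})"
proof -
  have "{k::nat. \<alpha> < real k \<and> real k \<le> \<beta>} = {nat \<lfloor>\<alpha>\<rfloor><..nat \<lfloor>\<beta>\<rfloor>}"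
  proof -
    have "\<alpha> < real k \<longleftrightarrow> nat \<lfloor>\<alpha>\<rfloor> < k" for k
      using assms by linarith
    moreover have "real k \<le> \<beta> \<longleftrightarrow> k \<le> nat \<lfloor>\<beta>\<rfloor>" if "0 < k" for k
      using that by linarith
    ultimately show ?thesis
      by auto
  qed
  then have "real (card {k::nat. \<alpha> < real k \<and> real k \<le> \<beta>}) = real (nat \<lfloor>\<beta>\<rfloor> - nat \<lfloor>\<alpha>\<rfloor>)"
    by simp
  then show ?thesis
    using assms by linarith
qed

text \<open>
  \<open>G\<close> consists of the monomials in \<open>A\<close> that are at most \<open>v\<close>; all that matters is that it is closed under
  the edges \<open>e -- a * e\<close> below \<open>v\<close>, that it is built from factors of \<open>A\<close>, and its odd majority.
\<close>

definition flip_block :: "nat set \<Rightarrow> nat \<Rightarrow> nat set \<Rightarrow> bool"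
  where "flip_block A v G \<longleftrightarrow> 0 < v \<and> G \<subseteq> {1..v}
    \<and> (\<forall>e\<in>G. \<forall>m. (\<forall>a\<in>A. coprime a m) \<longrightarrow> coprime e m)
    \<and> (\<forall>a\<in>A. \<forall>e. a * e \<le> v \<longrightarrow> (e \<in> G \<longleftrightarrow> a * e \<in> G))
    \<and> card (G \<inter> even_part A) < card (G - even_part A)"

lemma exists_flip_block:
  assumes base: "coprime_base A" and b: "b \<in> A" and c: "c \<in> A" and "b < c"
    and least: "\<And>a. a \<in> A \<Longrightarrow> a \<noteq> b \<Longrightarrow> c \<le> a"
  shows "\<exists>v G. flip_block A v G"
proof -
  have gt1: "1 < a" if "a \<in> A" for a
    using base that by (auto simp: coprime_base_def)
  have cop: "coprime a a'" if "a \<in> A" "a' \<in> A" "a \<noteq> a'" for a a'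
    using base that by (auto simp: coprime_base_def pairwise_def)
  have b1: "1 < b" and c1: "1 < c"
    using gt1 b c by auto
  \<comment> \<open>This makes \<open>b ^ (2 * q) < c\<close> strict and later keeps
    \<open>c\<close> from being counted among the odd powers of \<open>b\<close>.\<close>
  have c_neq: "b ^ i \<noteq> c" for i
  proof
    assume "b ^ i = c"
    moreover have "coprime (b ^ i) c"
      using cop[OF b c] \<open>b < c\<close> by simp
    ultimately show False
      using c1 by simp
  qed
  \<comment> \<open>The even powers of \<open>b\<close> around \<open>c\<close>:
    \<open>b ^ (2 * q) < c\<close> keeps \<open>b ^ (2 * q + 1)\<close> below \<open>b * c\<close>,
    and \<open>c < b ^ (2 * q + 2)\<close> makes \<open>2 * q + 1\<close> the last exponent up to
    \<open>v\<close>, leaving as many even as odd exponents.\<close>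
  define q where "q = (LEAST q. c < b ^ (2 * q + 2))"
  have "c < b ^ (2 * c + 2)"
  proof -
    have "c < b ^ c"
      using b1 by (simp add: power_gt_expt)
    also have "\<dots> \<le> b ^ (2 * c + 2)"
      using b1 by (intro power_increasing) auto
    finally show ?thesis .
  qed
  then have q_gt: "c < b ^ (2 * q + 2)"
    unfolding q_def by (rule LeastI)
  have q_lt: "b ^ (2 * q) < c"
  proof (cases q)
    case 0
    then show ?thesis
      using c1 by simp
  next
    case (Suc p)
    then have "\<not> c < b ^ (2 * p + 2)"
      using not_less_Least[of p "\<lambda>q. c < b ^ (2 * q + 2)"] by (simp add: q_def)
    then show ?thesis
      using c_neq[of "2 * q"] Suc by simp
  qed
  \<comment> \<open>With this \<open>v < b * c\<close>, only \<open>b ^ 0, \<dots>, b ^ (2 * q + 1)\<close> and elements of \<open>A\<close> are monomials up to \<open>v\<close>;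
    the powers balance, and \<open>c\<close> tips the parity.\<close>
  define v where "v = max (b ^ (2 * q + 1)) c"
  define G where "G = {b ^ i |i. i \<le> 2 * q + 1} \<union> {a \<in> A. a \<noteq> b \<and> a \<le> v}"
  have v_less: "v < b * c"
    using q_lt b1 c1 by (auto simp: v_def)
  have pow_le: "b ^ i \<le> v \<longleftrightarrow> i \<le> 2 * q + 1" for i
  proof
    assume "b ^ i \<le> v"
    also have "v < b ^ (2 * q + 2)"
      using q_gt b1 by (auto simp: v_def)
    finally show "i \<le> 2 * q + 1"
      using power_less_imp_less_exp[OF b1, of i "2 * q + 2"] by simp
  next
    assume "i \<le> 2 * q + 1"
    then have "b ^ i \<le> b ^ (2 * q + 1)"
      using b1 by (intro power_increasing) auto
    then show "b ^ i \<le> v"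
      by (simp add: v_def)
  qed
  \<comment> \<open>This rules out mixed products in the closure argument.\<close>
  have large: "v < a * a'" if "b \<le> a" "c \<le> a'" for a a'
    using v_less mult_le_mono[OF that] by linarith
  have b_le: "b \<le> a" if "a \<in> A" for a
    using least[OF that] \<open>b < c\<close> by (cases "a = b") auto
  have G_pos: "0 < e" and G_le: "e \<le> v" if "e \<in> G" for e
    using that gt1 b1 pow_le by (force simp: G_def)+
  have G_coprime: "coprime e m" if "e \<in> G" "\<forall>a\<in>A. coprime a m" for e m
    using that b by (auto simp: G_def)
  have G_step: "e \<in> G \<longleftrightarrow> a * e \<in> G" if a: "a \<in> A" and le: "a * e \<le> v" for a e
  proof
    assume "e \<in> G"
    then consider i where "e = b ^ i" | "e \<in> A" "e \<noteq> b"
      by (auto simp: G_def)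
    then show "a * e \<in> G"
    proof cases
      case 1
      show ?thesis
      proof (cases "a = b")
        case True
        then have "a * e = b ^ Suc i"
          using 1 by simp
        then show ?thesis
          using le pow_le[of "Suc i"] unfolding G_def by (intro UnI1 CollectI exI[of _ "Suc i"]) simp
      next
        case False
        show ?thesis
        proof (cases "i = 0")
          case True
          then show ?thesis
            using 1 a False le by (simp add: G_def)
        next
          case False
          then have "b \<le> e"
            using 1 b1 by (simp add: self_le_power)
          then show ?thesis
            using large[of e a] least[OF a \<open>a \<noteq> b\<close>] le by (simp add: mult.commute)
        qed
      qed
    next
      case 2
      then show ?thesis
        using large[of a e] b_le[OF a] least[of e] le by simp
    qed
  next
    assume "a * e \<in> G"
    then consider i where "a * e = b ^ i" "i \<le> 2 * q + 1" | "a * e \<in> A" "a * e \<noteq> b"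
      by (auto simp: G_def)
    then show "e \<in> G"
    proof cases
      case 1
      have "a = b"
      proof (rule ccontr)
        assume "a \<noteq> b"
        then have "coprime a (a * e)"
          unfolding 1 using cop[OF a b] by simp
        then show False
          using gt1[OF a] by simp
      qed
      moreover have "i \<noteq> 0"
        using 1 gt1[OF a] by (intro notI) auto
      ultimately have "e = b ^ (i - 1)"
        using 1 b1 by (cases i) auto
      then show ?thesis
        using 1 unfolding G_def by (intro UnI1 CollectI exI[of _ "i - 1"]) simp
    next
      case 2
      \<comment> \<open>By coprimality no element of \<open>A\<close> is a proper multiple of
        another, so \<open>e\<close> must be 1.\<close>
      have "a * e = a"
      proof (rule ccontr)
        assume "a * e \<noteq> a"
        then have "coprime a (a * e)"
          using cop[OF a 2(1)] by simp
        then show False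
          using gt1[OF a] by simp
      qed
      then have "e = b ^ 0"
        using gt1[OF a] by simp
      then show ?thesis
        unfolding G_def by blast
    qed
  qed
  have tot_1: "total_mult A 1 = 0"
    by (simp add: total_mult_def)
  have tot_pow: "total_mult A (b ^ i) = i" for i
    using b1 by (induction i) (use tot_1 in \<open>simp_all add: total_mult_times[OF base b]\<close>)
  have tot_A: "total_mult A a = 1" if "a \<in> A" for a
    using total_mult_times[OF base that, of 1] tot_1 by simp
  have even_sub: "G \<inter> even_part A \<subseteq> (\<lambda>i. b ^ (2 * i)) ` {..q}"
  proof
    fix e assume e: "e \<in> G \<inter> even_part A"
    then have "e \<notin> A"
      using tot_A by (auto simp: even_part_def)
    then obtain i where i: "e = b ^ i" "i \<le> 2 * q + 1"
      using e by (auto simp: G_def)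
    then have "even i"
      using e by (simp add: even_part_def tot_pow)
    then obtain j where "i = 2 * j" ..
    then show "e \<in> (\<lambda>i. b ^ (2 * i)) ` {..q}"
      using i by (intro image_eqI[of _ _ j]) auto
  qed
  have odd_sub: "insert c ((\<lambda>i. b ^ (2 * i + 1)) ` {..q}) \<subseteq> G - even_part A"
  proof -
    have "c \<in> G - even_part A"
      using c \<open>b < c\<close> tot_A[OF c] by (simp add: G_def even_part_def v_def)
    moreover have "b ^ (2 * i + 1) \<in> G - even_part A" if "i \<le> q" for i
    proof
      show "b ^ (2 * i + 1) \<in> G"
        unfolding G_def using that by (intro UnI1 CollectI exI[of _ "2 * i + 1"]) simp
      show "b ^ (2 * i + 1) \<notin> even_part A"
        unfolding even_part_def mem_Collect_eq tot_pow by simp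
    qed
    ultimately show ?thesis
      by blast
  qed
  have "card (G \<inter> even_part A) \<le> card ((\<lambda>i. b ^ (2 * i)) ` {..q})"
    using even_sub by (intro card_mono) auto
  also have "\<dots> \<le> q + 1"
    using card_image_le[of "{..q}" "\<lambda>i. b ^ (2 * i)"] by simp
  also have "\<dots> < card (insert c ((\<lambda>i. b ^ (2 * i + 1)) ` {..q}))"
  proof -
    have "inj_on (\<lambda>i. b ^ (2 * i + 1)) {..q}"
      using b1 by (auto intro!: inj_onI dest: power_inject_exp[THEN iffD1, rotated])
    then have "card ((\<lambda>i. b ^ (2 * i + 1)) ` {..q}) = q + 1"
      by (simp add: card_image)
    moreover have "c \<notin> (\<lambda>i. b ^ (2 * i + 1)) ` {..q}"
      using c_neq by (metis imageE)
    ultimately show ?thesis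
      by simp
  qed
  also have "\<dots> \<le> card (G - even_part A)"
  proof (intro card_mono odd_sub)
    have "G \<subseteq> {..v}"
      using G_le by auto
    then show "finite (G - even_part A)"
      by (simp add: finite_subset)
  qed
  finally have "card (G \<inter> even_part A) < card (G - even_part A)" .
  moreover have "G \<subseteq> {1..v}"
    using G_pos G_le by (fastforce simp: Suc_le_eq)
  moreover have "0 < v"
    using c1 by (simp add: v_def)
  ultimately have "flip_block A v G"
    unfolding flip_block_def using G_coprime G_step by blast
  then show ?thesis
    by blast
qed

text \<open>Parity is reversed on copies \<open>m * G\<close> with \<open>m\<close> coprime to every
  element of \<open>A\<close>. The copies are disjoint, multiplication by elements of
  \<open>A\<close> does not link them to the rest of the initial segment, and each gains at least
  one element; their number is at least linear in \<open>X\<close>.\<close>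

lemma exists_larger_quotient_free:
  assumes base: "coprime_base A" and block: "flip_block A v G"
  shows "\<exists>c>0. \<exists>X0. \<forall>X\<ge>X0. \<exists>T\<subseteq>initial_segment X. quotient_free A T \<and>
    real (card (even_part A \<inter> initial_segment X)) + c * X \<le> real (card T)"
proof -
  let ?E = "even_part A"
  have v: "0 < v" and G: "G \<subseteq> {1..v}" and card_G: "card (G \<inter> ?E) < card (G - ?E)"
    and G_coprime: "\<And>e m. e \<in> G \<Longrightarrow> (\<And>a. a \<in> A \<Longrightarrow> coprime a m) \<Longrightarrow> coprime e m"
    and G_step: "\<And>a e. a \<in> A \<Longrightarrow> a * e \<le> v \<Longrightarrow> e \<in> G \<longleftrightarrow> a * e \<in> G"
    using block by (auto simp: flip_block_def)
  have fin: "finite A" and gt1: "\<And>a. a \<in> A \<Longrightarrow> 1 < a"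
    using base by (auto simp: coprime_base_def)
  define N where "N = \<Prod>A"
  have "0 < N"
    unfolding N_def using gt1 by (intro prod_pos) (meson less_trans zero_less_one)
  \<comment> \<open>The multipliers number about \<open>X / (v * (v + 1) * N) = 2 * c * X\<close>;
    half of this absorbs the rounding error once \<open>c * X \<ge> 1\<close>.\<close>
  define c where "c = 1 / (2 * real v * real (v + 1) * real N)"
  have "0 < c"
    using v \<open>0 < N\<close> by (simp add: c_def)
  show ?thesis
  proof (rule exI[of _ c], rule conjI[OF \<open>0 < c\<close>],
      rule exI[of _ "max (real (v + 1)) (1 / c)"], intro allI impI)
    fix X :: real
    assume "max (real (v + 1)) (1 / c) \<le> X"
    then have X: "real (v + 1) \<le> X" "1 \<le> c * X"
      using \<open>0 < c\<close> by (auto simp: field_simps)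
    \<comment> \<open>The bounds on \<open>k\<close> place \<open>m = 1 + N * k\<close> in
      \<open>(X / (v + 1), X / v]\<close>; being 1 modulo \<open>N\<close> makes \<open>m\<close>
      coprime to all of \<open>A\<close>.\<close>
    define K where "K = {k::nat. (X / real (v + 1) - 1) / real N < real k \<and> real k \<le> (X / real v - 1) / real N}"
    define J where "J = (\<lambda>k. 1 + N * k) ` K"
    define F where "F = (\<lambda>(m, e). m * e) ` (J \<times> G)"
    define I where "I = initial_segment X"
    define T where "T = (?E \<inter> I - F) \<union> (F - ?E)"
    have fin_G: "finite G"
      using G by (rule finite_subset) simp
    have "K \<subseteq> {..nat \<lfloor>(X / real v - 1) / real N\<rfloor>}"
      unfolding K_def by (auto simp: le_nat_iff le_floor_iff)
    then have fin_J: "finite J"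
      unfolding J_def by (intro finite_imageI) (rule finite_subset, auto)
    have J_bounds: "X / real (v + 1) < real m" "real m \<le> X / real v" and J_coprime: "\<And>a. a \<in> A \<Longrightarrow> coprime a m"
      if "m \<in> J" for m
    proof -
      obtain k where k: "m = 1 + N * k" "k \<in> K"
        using \<open>m \<in> J\<close> by (auto simp: J_def)
      have "X / real (v + 1) - 1 < real N * real k" "real N * real k \<le> X / real v - 1"
        using k(2) \<open>0 < N\<close> by (auto simp: K_def pos_divide_less_eq pos_le_divide_eq mult.commute simp del: of_nat_add)
      then show "X / real (v + 1) < real m" "real m \<le> X / real v"
        unfolding k(1) of_nat_add[of 1] of_nat_mult of_nat_1 by linarith+
      fix a assume "a \<in> A"
      then have "a dvd N"
        unfolding N_def using fin by (rule dvd_prodI[rotated])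
      moreover have "coprime N m"
      proof (rule coprimeI)
        fix d assume "d dvd N" "d dvd m"
        then have "d dvd N * k" "d dvd 1 + N * k"
          by (auto simp: k(1))
        then show "is_unit d"
          by (rule dvd_add_left_iff[THEN iffD1])
      qed
      ultimately show "coprime a m"
        by (rule coprime_divisors[OF _ dvd_refl])
    qed
    \<comment> \<open>The interval for \<open>m\<close> was chosen for this: on each copy, the
      cutoff at \<open>X\<close> becomes the cutoff of \<open>G\<close> at \<open>v\<close>.\<close>
    have J_le_iff: "real (m * e) \<le> X \<longleftrightarrow> e \<le> v" if "m \<in> J" for m e
    proof
      assume "real (m * e) \<le> X"
      also have "X < real m * real (v + 1)"
        using J_bounds(1)[OF that] v by (simp add: pos_divide_less_eq)
      finally have "m * e < m * (v + 1)"
        by (metis of_nat_less_iff of_nat_mult)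
      then show "e \<le> v"
        unfolding mult_less_cancel1 by simp
    next
      assume "e \<le> v"
      then have "real (m * e) \<le> real m * real v"
        by (simp add: mult_left_mono)
      also have "\<dots> \<le> X"
        using J_bounds(2)[OF that] v by (simp add: pos_le_divide_eq)
      finally show "real (m * e) \<le> X" .
    qed
    have J_pos: "0 < m" if "m \<in> J" for m
      using that by (auto simp: J_def)
    have F_sub: "F \<subseteq> I"
    proof
      fix n assume "n \<in> F"
      then obtain m e where me: "m \<in> J" "e \<in> G" "n = m * e"
        by (auto simp: F_def)
      then have "0 < e" "e \<le> v"
        using G by auto
      then show "n \<in> I"
        using me J_le_iff[of m e] J_pos[of m] unfolding I_def initial_segment_def by simp
    qed
    \<comment> \<open>No pair \<open>n\<close>, \<open>a * n\<close> inside \<open>I\<close>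
      straddles the boundary of \<open>F\<close>, so the swap creates no conflict there. Downwards,
      \<open>a\<close> is coprime to \<open>m\<close> and must divide \<open>e\<close>.\<close>
    have F_step: "n \<in> F \<longleftrightarrow> a * n \<in> F" if a: "a \<in> A" and le: "a * n \<in> I" for a n
    proof
      assume "n \<in> F"
      then obtain m e where me: "m \<in> J" "e \<in> G" "n = m * e"
        by (auto simp: F_def)
      then have "a * e \<le> v"
        using le J_le_iff[of m "a * e"] unfolding I_def initial_segment_def me(3)
        by (simp add: mult.left_commute)
      then have "a * e \<in> G"
        using G_step[OF a] me by simp
      then show "a * n \<in> F"
        using me by (auto simp: F_def intro!: image_eqI[of _ _ "(m, a * e)"])
    next
      assume "a * n \<in> F"
      then obtain m e where me: "m \<in> J" "e \<in> G" "a * n = m * e"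
        by (auto simp: F_def)
      then have "a dvd m * e"
        by (metis dvd_triv_left)
      then have "a dvd e"
        using J_coprime[OF me(1) a] by (simp add: coprime_dvd_mult_right_iff)
      then obtain e' where e': "e = a * e'" ..
      then have "n = m * e'"
        using me(3) gt1[OF a] by simp
      moreover have "e' \<in> G"
        using G_step[OF a, of e'] me(2) G e' by auto
      ultimately show "n \<in> F"
        using me(1) by (auto simp: F_def)
    qed
    \<comment> \<open>Each \<open>m\<close> is coprime to \<open>A\<close> and each \<open>e\<close>
      is built from \<open>A\<close>, so equal products force \<open>e\<close> and \<open>e'\<close>
      to divide each other.\<close>
    have inj: "inj_on (\<lambda>(m, e). m * e) (J \<times> G)"
    proof (rule inj_onI, clarify)
      fix m e m' e'
      assume m: "m \<in> J" "m' \<in> J" and e: "e \<in> G" "e' \<in> G" and eq: "m * e = m' * e'"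
      have "coprime e m'" "coprime e' m"
        using G_coprime e J_coprime m by blast+
      then have "e dvd e'" "e' dvd e"
        using eq by (metis coprime_dvd_mult_right_iff dvd_triv_right)+
      then have "e = e'"
        by (rule dvd_antisym)
      moreover have "0 < e"
        using G e by auto
      ultimately show "m = m' \<and> e = e'"
        using eq by simp
    qed
    have F_even: "m * e \<in> ?E \<longleftrightarrow> e \<in> ?E" if "m \<in> J" "e \<in> G" for m e
      using that G J_pos J_coprime by (auto simp: even_part_def total_mult_mult_coprime)
    have "F \<inter> ?E = (\<lambda>(m, e). m * e) ` (J \<times> (G \<inter> ?E))"
      using F_even by (auto simp: F_def)
    then have card_even: "card (F \<inter> ?E) = card J * card (G \<inter> ?E)"
      by (simp add: card_image inj_on_subset[OF inj] Sigma_mono flip: card_cartesian_product)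
    have "F - ?E = (\<lambda>(m, e). m * e) ` (J \<times> (G - ?E))"
      using F_even by (auto simp: F_def)
    then have card_odd: "card (F - ?E) = card J * card (G - ?E)"
      by (simp add: card_image inj_on_subset[OF inj] Sigma_mono flip: card_cartesian_product)
    have fin_F: "finite F" and fin_I: "finite I"
      using fin_J fin_G by (auto simp: F_def I_def)
    have "card (?E \<inter> I) + card J \<le> card T"
    proof -
      have "card (?E \<inter> I) = card (?E \<inter> I - F) + card (F \<inter> ?E)"
        using F_sub fin_I fin_F
        by (subst card_Un_disjoint[symmetric]) (auto intro!: arg_cong[where f = card])
      moreover have "card T = card (?E \<inter> I - F) + card (F - ?E)"
        unfolding T_def using fin_I fin_F by (intro card_Un_disjoint) auto
      moreover have "card J * card (G \<inter> ?E) + card J \<le> card J * card (G - ?E)"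
        using card_G mult_le_mono2[of "Suc (card (G \<inter> ?E))" "card (G - ?E)" "card J"] by simp
      ultimately show ?thesis
        by (simp add: card_even card_odd)
    qed
    moreover have "c * X \<le> real (card J)"
    proof -
      have "card J = card K"
        unfolding J_def using \<open>0 < N\<close> by (intro card_image inj_onI) simp
      moreover have "(X / real v - 1) / real N - (X / real (v + 1) - 1) / real N - 1 \<le> real (card K)"
        unfolding K_def using X(1) by (intro card_nat_interval_ge) (simp add: pos_le_divide_eq)
      moreover have "(X / real v - 1) / real N - (X / real (v + 1) - 1) / real N = 2 * (c * X)"
        using v \<open>0 < N\<close> by (simp add: c_def divide_simps) (simp add: algebra_simps)
      ultimately show ?thesis
        using X(2) by simp
    qed
    moreover have "quotient_free A T"
      unfolding quotient_free_iff
    proof (intro conjI ballI notI)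
      show "0 < x" if "x \<in> T" for x
        using that F_sub by (auto simp: T_def I_def initial_segment_def)
    next
      fix a y assume a: "a \<in> A" and y: "y \<in> T" and ay: "a * y \<in> T"
      have "a * y \<in> I" "y \<in> I"
        using ay y F_sub by (auto simp: T_def)
      then have "y \<in> F \<longleftrightarrow> a * y \<in> F" and "0 < y"
        using F_step[OF a] by (auto simp: I_def initial_segment_def)
      \<comment> \<open>Parity alternates along the pair while membership in \<open>F\<close>
        agrees, so \<open>T\<close> contains at most one of the two.\<close>
      moreover have "y \<in> ?E \<longleftrightarrow> a * y \<notin> ?E"
        using \<open>0 < y\<close> gt1[OF a] by (simp add: even_part_def total_mult_times[OF base a])
      ultimately show False
        using y ay by (auto simp: T_def)
    qed
    moreover have "T \<subseteq> I"
      using F_sub by (auto simp: T_def)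
    ultimately show "\<exists>T\<subseteq>initial_segment X. quotient_free A T \<and>
      real (card (?E \<inter> initial_segment X)) + c * X \<le> real (card T)"
      unfolding I_def by (intro exI[of _ T]) auto
  qed
qed

section \<open>Strict separation of the two suprema by the upper density of the even part\<close>

theorem theorem7:
  fixes r :: nat and a :: "nat \<Rightarrow> nat" and A :: "nat set"
  assumes "2 \<le> r"
    and "A = a ` {1..r}"
    and "1 < a 1"
    and "\<And>i j. 1 \<le> i \<Longrightarrow> i < j \<Longrightarrow> j \<le> r \<Longrightarrow> a i < a j"
    and "\<And>i j. i \<in> {1..r} \<Longrightarrow> j \<in> {1..r} \<Longrightarrow> i \<noteq> j \<Longrightarrow> coprime (a i) (a j)"
  shows "upper_rho A > rho A"
proof -
  let ?E = "even_part A"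
  have gt1: "1 < a i" if "i \<in> {1..r}" for i
    using that assms(3) assms(4)[of 1 i] by (cases "i = 1") auto
  have base: "coprime_base A"
    unfolding coprime_base_def
  proof (intro conjI ballI pairwiseI)
    show "finite A"
      by (simp add: assms(2))
    show "1 < x" if "x \<in> A" for x
      using that gt1 by (auto simp: assms(2))
    show "coprime x y" if "x \<in> A" "y \<in> A" "x \<noteq> y" for x y
      using that assms(5) unfolding assms(2) by blast
  qed
  have "\<exists>v G. flip_block A v G"
  proof (rule exists_flip_block[OF base])
    show "a 1 \<in> A" "a 2 \<in> A" "a 1 < a 2"
      using assms(1) assms(4)[of 1 2] by (auto simp: assms(2))
    fix x assume "x \<in> A" "x \<noteq> a 1"
    then obtain i where i: "x = a i" "1 \<le> i" "i \<le> r"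
      by (auto simp: assms(2))
    then have "i \<noteq> 1"
      using \<open>x \<noteq> a 1\<close> by auto
    then have "i = 2 \<or> 2 < i"
      using i(2) by linarith
    then show "a 2 \<le> x"
      using assms(4)[of 2 i] i by auto
  qed
  then obtain c X0 where "0 < c" and larger: "\<And>X. X0 \<le> X \<Longrightarrow> \<exists>T\<subseteq>initial_segment X. quotient_free A T \<and>
      real (card (?E \<inter> initial_segment X)) + c * X \<le> real (card T)"
    using exists_larger_quotient_free[OF base] by metis
  \<comment> \<open>Finiteness of this upper density makes adding \<open>c / 2\<close> a strict
    increase.\<close>
  have "upper_density ?E \<le> ereal 1"
    unfolding upper_density_def
  proof (rule Limsup_bounded, rule eventually_mono[OF eventually_gt_at_top[of 0]])
    fix X :: real assume "0 < X"
    moreover have "real (card (?E \<inter> initial_segment X)) \<le> real (card (initial_segment X))"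
      by (simp add: card_mono)
    ultimately show "ereal (real (card (?E \<inter> initial_segment X)) / X) \<le> ereal 1"
      using card_initial_segment_le[of X] by simp
  qed
  moreover have "ereal 0 \<le> upper_density ?E"
    unfolding upper_density_def
    by (rule le_Limsup, simp, rule eventually_mono[OF eventually_gt_at_top[of 0]]) simp
  ultimately obtain u where u: "upper_density ?E = ereal u"
    by (cases "upper_density ?E") auto
  have "rho A \<le> ereal u"
    unfolding rho_def u[symmetric]
    using density_le_upper_density_even_part[OF base] by (auto intro!: Sup_least)
  also have "ereal u < ereal (u + c / 2)"
    using \<open>0 < c\<close> by simp
  also have "\<dots> \<le> upper_rho A"
  proof (rule upper_rho_ge_of_finite)
    show "finite A"
      using base by (simp add: coprime_base_def)
    fix Y :: real
    \<comment> \<open>Half of the gain \<open>c\<close> pays for the even part coming only within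
      \<open>c / 2\<close> of its upper density at the chosen \<open>X\<close>.\<close>
    have "ereal (u - c / 2) < upper_density ?E"
      using \<open>0 < c\<close> by (simp add: u)
    moreover have "upper_density ?E \<le> Limsup at_top (\<lambda>X. ereal (real (card (?E \<inter> initial_segment X)) / X))"
      by (simp add: upper_density_def)
    ultimately have "\<exists>X\<ge>max 1 (max X0 Y). ereal (u - c / 2) < ereal (real (card (?E \<inter> initial_segment X)) / X)"
      unfolding le_Limsup_at_top_iff by blast
    then obtain X where X: "max 1 (max X0 Y) \<le> X" "u - c / 2 < real (card (?E \<inter> initial_segment X)) / X"
      by auto
    then obtain T where T: "T \<subseteq> initial_segment X" "quotient_free A T"
      "real (card (?E \<inter> initial_segment X)) + c * X \<le> real (card T)"
      using larger[of X] by auto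
    have "(u - c / 2) * X < real (card (?E \<inter> initial_segment X))"
      using X by (simp add: pos_less_divide_eq)
    then have "(u + c / 2) * X \<le> real (card T)"
      using T(3) by (simp add: algebra_simps)
    then show "\<exists>X T. Y \<le> X \<and> T \<subseteq> initial_segment X \<and> quotient_free A T \<and> (u + c / 2) * X \<le> real (card T)"
      using X T by auto
  qed
  finally show ?thesis .
qed

end
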